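(* Any graph $\mathcal{G}$ which contains faithfully any of the graphs $\mathcal{G}_{2,2,0}$, $\mathcal{G}_{0,0,3}$, $\mathcal{G}_{2,1,1}$, $\mathcal{G}_{4,1,0}$, $\mathcal{G}_{2,0,2}$, $\mathcal{G}_{4,0,1}$, $\mathcal{G}_{1,1,2}$ is not positive.
   Context: Graphs are finite, simple, and have at least one edge. The valency of a vertex is the number of edges containing it; two distinct edges are adjacent if they share a vertex. For integers $r\ge s\ge0$, $t\ge0$ with $s\ne0$ or $t\ne0$, $\mathcal{G}_{r,s,t}$ is the graph with $r+s+t+2$ vertices and $r+s+2t+1$ edges consisting of an edge $l=vw$ together with $r$ vertices joined only to $v$, $s$ vertices joined only to $w$, and $t$ vertices joined exactly to both $v$ and $w$ (so $l$ is adjacent to every other edge). A graph $\mathcal{G}$ contains faithfully $\mathcal{G}_{r,s,t}$ if it has an edge $l=vw$ and $r+s+t$ distinct further vertices such that $r$ of them are joined to $v$ and have valency one in $\mathcal{G}$, $s$ of them are joined to $w$ and have valency one in $\mathcal{G}$, and the remaining $t$ are joined to both $v$ and $w$ and have valency two in $\mathcal{G}$. The line graph $L(\mathcal{G})$ is the graph whose vertices are the edges $l_1,\dots,l_q$ of $\mathcal{G}$, two being joined iff they are adjacent, and $\mathrm{Adj}\,L(\mathcal{G})$ is its $q\times q$ adjacency matrix. The matrix $3I+\mathrm{Adj}\,L(\mathcal{G})$ is positive definite, and $\mathcal{G}$ is called positive if all entries of the vector $(3I+\mathrm{Adj}\,L(\mathcal{G}))^{-1}(1,\dots,1)^t$ are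 positive. *)

theory Defs
  imports Complex_Main "Jordan_Normal_Form.Gauss_Jordan_Elimination"
    "Jordan_Normal_Form.Determinant"
begin

type_synonym 'a graph = "'a set \<times> 'a set set"

abbreviation verts :: "'a graph \<Rightarrow> 'a set" where "verts G \<equiv> fst G"

abbreviation edges :: "'a graph \<Rightarrow> 'a set set" where "edges G \<equiv> snd G"

definition graph :: "'a graph \<Rightarrow> bool" where
  "graph G \<longleftrightarrow>
     finite (verts G) \<and> (\<forall>e\<in>edges G. e \<subseteq> verts G \<and> card e = 2) \<and> edges G \<noteq> {}"

definition valency :: "'a graph \<Rightarrow> 'a \<Rightarrow> nat" where
  "valency G x = card {e \<in> edges G. x \<in> e}"

definition adjacent_edges :: "'a set \<Rightarrow> 'a set \<Rightarrow> bool" where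
  "adjacent_edges e f \<longleftrightarrow> e \<noteq> f \<and> e \<inter> f \<noteq> {}"

text \<open>
  The graph with parameters \<open>r\<close>, \<open>s\<close>, \<open>t\<close> consists of an edge \<open>l = {v, w}\<close>, of \<open>r\<close> (resp. \<open>s\<close>) further
  vertices joined only to \<open>v\<close> (resp. \<open>w\<close>), and of \<open>t\<close> further vertices joined exactly to \<open>v\<close> and
  \<open>w\<close>. Faithful containment depends only on the three parameters. The pair \<open>v\<close>, \<open>w\<close> is
  existentially quantified in order, so either end of \<open>l\<close> may carry the \<open>r\<close> pendant vertices.
  The valencies of \<open>v\<close> and \<open>w\<close> are unrestricted. The convention \<open>r \<ge> s\<close> and
  \<open>s \<noteq> 0 \<or> t \<noteq> 0\<close> on the parameters is not imposed here.
\<close>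

definition contains_faithfully :: "'a graph \<Rightarrow> nat \<Rightarrow> nat \<Rightarrow> nat \<Rightarrow> bool" where
  "contains_faithfully G r s t \<longleftrightarrow>
     (\<exists>v w R S T.
        {v, w} \<in> edges G \<and>
        R \<subseteq> verts G - {v, w} \<and> S \<subseteq> verts G - {v, w} \<and> T \<subseteq> verts G - {v, w} \<and>
        R \<inter> S = {} \<and> R \<inter> T = {} \<and> S \<inter> T = {} \<and>
        card R = r \<and> card S = s \<and> card T = t \<and>
        (\<forall>x\<in>R. {v, x} \<in> edges G \<and> valency G x = 1) \<and>
        (\<forall>x\<in>S. {w, x} \<in> edges G \<and> valency G x = 1) \<and>
        (\<forall>x\<in>T. {v, x} \<in> edges G \<and> {w, x} \<in> edges G \<and> valency G x = 2))"

definition line_graph :: "'a graph \<Rightarrow> 'a set graph" where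
  "line_graph G =
     (edges G, {{e, f} | e f. e \<in> edges G \<and> f \<in> edges G \<and> adjacent_edges e f})"

text \<open>The adjacency matrix relative to an enumeration \<open>xs\<close> of the vertices.\<close>

definition adjacency_matrix :: "'a graph \<Rightarrow> 'a list \<Rightarrow> real mat" where
  "adjacency_matrix G xs =
     mat (length xs) (length xs) (\<lambda>(i, j). if {xs ! i, xs ! j} \<in> edges G then 1 else 0)"

definition positivity_matrix :: "'a graph \<Rightarrow> 'a set list \<Rightarrow> real mat" where
  "positivity_matrix G ls = 3 \<cdot>\<^sub>m 1\<^sub>m (length ls) + adjacency_matrix (line_graph G) ls"

definition all_entries_positive :: "'a graph \<Rightarrow> 'a set list \<Rightarrow> bool" where
  "all_entries_positive G ls \<longleftrightarrow>
     (\<forall>i < length ls.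
        (the (mat_inverse (positivity_matrix G ls)) *\<^sub>v vec (length ls) (\<lambda>_. 1)) $ i > 0)"

text \<open>
  The choice of the enumeration is immaterial (\<open>graph_positive_iff\<close>), and the inverse always
  exists (\<open>positivity_matrix_inverse\<close>).
\<close>

definition graph_positive :: "'a graph \<Rightarrow> bool" where
  "graph_positive G \<longleftrightarrow>
     (\<exists>ls. distinct ls \<and> set ls = edges G \<and> all_entries_positive G ls)"

lemma positivity_matrix_carrier [simp]:
  "positivity_matrix G ls \<in> carrier_mat (length ls) (length ls)"
  by (simp add: positivity_matrix_def adjacency_matrix_def)

lemma line_graph_edge_iff:
  assumes "e \<in> edges G" "f \<in> edges G"
  shows "{e, f} \<in> edges (line_graph G) \<longleftrightarrow> adjacent_edges e f"
  using assms by (auto simp: line_graph_def adjacent_edges_def doubleton_eq_iff)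

definition edge_coeff :: "'a set \<Rightarrow> 'a set \<Rightarrow> real" where
  "edge_coeff e f = (if e = f then 3 else if e \<inter> f \<noteq> {} then 1 else 0)"

lemma positivity_matrix_index:
  assumes "distinct ls" "set ls = edges G" "i < length ls" "j < length ls"
  shows "positivity_matrix G ls $$ (i, j) = edge_coeff (ls ! i) (ls ! j)"
proof -
  have "ls ! i \<in> edges G" "ls ! j \<in> edges G"
    using assms by (metis nth_mem)+
  then show ?thesis
    using assms line_graph_edge_iff[of "ls ! i" G "ls ! j"]
    by (auto simp: positivity_matrix_def adjacency_matrix_def edge_coeff_def
        adjacent_edges_def nth_eq_iff_index_eq)
qed

lemma edge_coeff_eq:
  assumes "graph G" "e \<in> edges G" "f \<in> edges G"
  shows "edge_coeff e f =
    (if e = f then 1 else 0) + (\<Sum>v\<in>verts G. of_bool (v \<in> e) * of_bool (v \<in> f))"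
proof -
  have fin: "finite (verts G)" and e: "e \<subseteq> verts G" "card e = 2"
    and f: "f \<subseteq> verts G" "card f = 2"
    using assms by (auto simp: graph_def)
  have "(\<Sum>v\<in>verts G. of_bool (v \<in> e) * of_bool (v \<in> f)) =
      (\<Sum>v\<in>verts G. of_bool (v \<in> e \<inter> f) :: real)"
    by (intro sum.cong) auto
  also have "\<dots> = real (card (verts G \<inter> (e \<inter> f)))"
    using fin by (simp add: of_bool_def sum.If_cases Int_def)
  also have "verts G \<inter> (e \<inter> f) = e \<inter> f"
    using e by auto
  finally have *: "(\<Sum>v\<in>verts G. of_bool (v \<in> e) * of_bool (v \<in> f)) = real (card (e \<inter> f))" .
  have fe: "finite e" "finite f"
    using e f fin finite_subset by auto
  have "card (e \<inter> f) = 1" if ne: "e \<noteq> f" "e \<inter> f \<noteq> {}"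
  proof -
    have "e \<inter> f \<subset> e"
      using ne e f fe by (metis card_subset_eq inf.cobounded1 inf.cobounded2 psubsetI)
    then have "card (e \<inter> f) < 2"
      using psubset_card_mono[OF fe(1)] e by simp
    moreover have "card (e \<inter> f) > 0"
      using ne fe by (simp add: card_gt_0_iff)
    ultimately show ?thesis by simp
  qed
  then show ?thesis
    unfolding * using e by (auto simp: edge_coeff_def)
qed

lemma sum_nth_distinct:
  assumes "distinct ls"
  shows "(\<Sum>j = 0..<length ls. g (ls ! j)) = (\<Sum>e\<in>set ls. g e)"
  using sum.reindex_bij_betw[OF bij_betw_nth[OF assms refl refl], of g]
  by (simp add: atLeast0LessThan)

lemma edge_form:
  assumes "graph G"
  shows "(\<Sum>e\<in>edges G. \<Sum>f\<in>edges G. x e * edge_coeff e f * x f) =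
    (\<Sum>e\<in>edges G. (x e)\<^sup>2) + (\<Sum>v\<in>verts G. (\<Sum>e\<in>edges G. of_bool (v \<in> e) * x e)\<^sup>2)"
proof -
  have "edges G \<subseteq> Pow (verts G)"
    using assms by (auto simp: graph_def)
  then have fin: "finite (edges G)"
    using assms by (meson finite_Pow_iff finite_subset graph_def)
  have "(\<Sum>e\<in>edges G. \<Sum>f\<in>edges G. x e * edge_coeff e f * x f) =
    (\<Sum>e\<in>edges G. \<Sum>f\<in>edges G. (if e = f then x e * x f else 0) +
       (\<Sum>v\<in>verts G. (of_bool (v \<in> e) * x e) * (of_bool (v \<in> f) * x f)))"
    by (intro sum.cong refl)
      (simp add: edge_coeff_eq[OF assms] algebra_simps sum_distrib_left)
  also have "\<dots> = (\<Sum>e\<in>edges G. (x e)\<^sup>2) + (\<Sum>e\<in>edges G. \<Sum>f\<in>edges G.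
       \<Sum>v\<in>verts G. (of_bool (v \<in> e) * x e) * (of_bool (v \<in> f) * x f))"
    using fin by (simp add: sum.distrib power2_eq_square)
  also have "(\<Sum>e\<in>edges G. \<Sum>f\<in>edges G.
       \<Sum>v\<in>verts G. (of_bool (v \<in> e) * x e) * (of_bool (v \<in> f) * x f)) =
     (\<Sum>e\<in>edges G. \<Sum>v\<in>verts G. \<Sum>f\<in>edges G.
       (of_bool (v \<in> e) * x e) * (of_bool (v \<in> f) * x f))"
    by (intro sum.cong refl, rule sum.swap)
  also have "\<dots> = (\<Sum>v\<in>verts G. \<Sum>e\<in>edges G. \<Sum>f\<in>edges G.
       (of_bool (v \<in> e) * x e) * (of_bool (v \<in> f) * x f))"
    by (rule sum.swap)
  also have "\<dots> = (\<Sum>v\<in>verts G. (\<Sum>e\<in>edges G. of_bool (v \<in> e) * x e)\<^sup>2)"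
    by (simp only: power2_eq_square sum_product)
  finally show ?thesis .
qed

lemma edge_system_unique:
  assumes "graph G"
    and "\<And>e. e \<in> edges G \<Longrightarrow> (\<Sum>f\<in>edges G. edge_coeff e f * x f) = 0"
    and "e \<in> edges G"
  shows "x e = 0"
proof -
  have "edges G \<subseteq> Pow (verts G)"
    using assms by (auto simp: graph_def)
  then have fin: "finite (edges G)"
    using assms by (meson finite_Pow_iff finite_subset graph_def)
  have "(\<Sum>e\<in>edges G. \<Sum>f\<in>edges G. x e * edge_coeff e f * x f) =
      (\<Sum>e\<in>edges G. x e * (\<Sum>f\<in>edges G. edge_coeff e f * x f))"
    by (simp add: sum_distrib_left mult.assoc)
  also have "\<dots> = 0"
    using assms(2) by simp
  finally have "(\<Sum>e\<in>edges G. (x e)\<^sup>2) +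
      (\<Sum>v\<in>verts G. (\<Sum>e\<in>edges G. of_bool (v \<in> e) * x e)\<^sup>2) = 0"
    by (simp add: edge_form[OF assms(1)])
  moreover have "(\<Sum>v\<in>verts G. (\<Sum>e\<in>edges G. of_bool (v \<in> e) * x e)\<^sup>2) \<ge> 0"
    "(\<Sum>e\<in>edges G. (x e)\<^sup>2) \<ge> 0"
    by (intro sum_nonneg; simp)+
  ultimately have "(\<Sum>e\<in>edges G. (x e)\<^sup>2) = 0"
    by linarith
  then show ?thesis
    using fin assms(3) by (simp add: sum_nonneg_eq_0_iff)
qed

lemma positivity_matrix_mult_vec:
  assumes "distinct ls" "set ls = edges G" "i < length ls"
  shows "(positivity_matrix G ls *\<^sub>v vec (length ls) (\<lambda>j. x (ls ! j))) $ i =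
    (\<Sum>f\<in>edges G. edge_coeff (ls ! i) f * x f)"
proof -
  have "(positivity_matrix G ls *\<^sub>v vec (length ls) (\<lambda>j. x (ls ! j))) $ i =
      (\<Sum>j = 0..<length ls. edge_coeff (ls ! i) (ls ! j) * x (ls ! j))"
    using assms carrier_matD[OF positivity_matrix_carrier[of G ls]]
    by (simp add: scalar_prod_def positivity_matrix_index)
  then show ?thesis
    using sum_nth_distinct[OF assms(1), of "\<lambda>f. edge_coeff (ls ! i) f * x f"] assms(2) by simp
qed

lemma vec_as_edge_fun:
  assumes "distinct ls" "v \<in> carrier_vec (length ls)"
  obtains x where "v = vec (length ls) (\<lambda>j. x (ls ! j))"
proof
  let ?x = "\<lambda>e. v $ (THE j. j < length ls \<and> ls ! j = e)"
  have "(THE k. k < length ls \<and> ls ! k = ls ! j) = j" if "j < length ls" for j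
    using that assms(1) by (intro the_equality) (auto simp: nth_eq_iff_index_eq)
  then show "v = vec (length ls) (\<lambda>j. ?x (ls ! j))"
    using assms(2) by (intro eq_vecI) auto
qed

lemma positivity_matrix_inverse:
  assumes "graph G" "distinct ls" "set ls = edges G"
  obtains B where "mat_inverse (positivity_matrix G ls) = Some B"
    "B \<in> carrier_mat (length ls) (length ls)"
    "positivity_matrix G ls * B = 1\<^sub>m (length ls)"
    "B * positivity_matrix G ls = 1\<^sub>m (length ls)"
proof -
  let ?M = "positivity_matrix G ls" and ?n = "length ls"
  have "det ?M \<noteq> 0"
  proof
    assume "det ?M = 0"
    then obtain v where v: "v \<in> carrier_vec ?n" "v \<noteq> 0\<^sub>v ?n" "?M *\<^sub>v v = 0\<^sub>v ?n"
      using det_0_iff_vec_prod_zero_field[OF positivity_matrix_carrier] by blast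
    obtain x where x: "v = vec ?n (\<lambda>j. x (ls ! j))"
      using vec_as_edge_fun[OF assms(2) v(1)] .
    have "(\<Sum>f\<in>edges G. edge_coeff e f * x f) = 0" if e: "e \<in> edges G" for e
    proof -
      obtain i where "i < ?n" "e = ls ! i"
        using e unfolding assms(3)[symmetric] in_set_conv_nth by blast
      then show ?thesis
        using positivity_matrix_mult_vec[OF assms(2,3), of i x] v(3) by (simp add: x)
    qed
    then have "x e = 0" if "e \<in> edges G" for e
      using edge_system_unique[OF assms(1)] that by blast
    then have "v = 0\<^sub>v ?n"
      unfolding x using assms(3) nth_mem[of _ ls] by (intro eq_vecI) simp_all
    with v(2) show False by simp
  qed
  then have "?M \<in> Units (ring_mat TYPE(real) ?n ())"
    by (rule det_non_zero_imp_unit[OF positivity_matrix_carrier])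
  then have "mat_inverse ?M \<noteq> None"
    using mat_inverse(1)[OF positivity_matrix_carrier[of G ls], of "()"] by auto
  then obtain B where B: "mat_inverse ?M = Some B"
    by auto
  then show ?thesis
    using mat_inverse(2)[OF positivity_matrix_carrier B] that by simp
qed

lemma all_entries_positive_iff:
  assumes "graph G" "distinct ls" "set ls = edges G"
  shows "all_entries_positive G ls \<longleftrightarrow>
    (\<exists>x. (\<forall>e\<in>edges G. (\<Sum>f\<in>edges G. edge_coeff e f * x f) = 1) \<and> (\<forall>e\<in>edges G. x e > 0))"
proof -
  let ?M = "positivity_matrix G ls" and ?n = "length ls"
  let ?one = "vec ?n (\<lambda>_. 1) :: real vec"
  obtain B where B: "mat_inverse ?M = Some B" "B \<in> carrier_mat ?n ?n"
    "?M * B = 1\<^sub>m ?n" "B * ?M = 1\<^sub>m ?n"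
    using positivity_matrix_inverse[OF assms] .
  have ex_nth: "\<exists>i < ?n. e = ls ! i" if "e \<in> edges G" for e
    using that unfolding assms(3)[symmetric] in_set_conv_nth by blast
  show ?thesis
  proof
    assume pos: "all_entries_positive G ls"
    have "B *\<^sub>v ?one \<in> carrier_vec ?n"
      using B(2) by auto
    then obtain x where x: "B *\<^sub>v ?one = vec ?n (\<lambda>j. x (ls ! j))"
      using vec_as_edge_fun[OF assms(2)] by blast
    have "?M *\<^sub>v (B *\<^sub>v ?one) = (?M * B) *\<^sub>v ?one"
      by (rule assoc_mult_mat_vec[OF positivity_matrix_carrier B(2), symmetric]) simp
    then have Mx: "?M *\<^sub>v vec ?n (\<lambda>j. x (ls ! j)) = ?one"
      unfolding x B(3) by simp
    have "(\<Sum>f\<in>edges G. edge_coeff e f * x f) = 1 \<and> x e > 0" if e: "e \<in> edges G" for e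
    proof -
      obtain i where i: "i < ?n" "e = ls ! i"
        using ex_nth[OF e] by blast
      have "(\<Sum>f\<in>edges G. edge_coeff e f * x f) = 1"
        using positivity_matrix_mult_vec[OF assms(2,3) i(1), of x] i by (simp add: Mx)
      moreover have "x e > 0"
        using pos i by (simp add: all_entries_positive_def B(1) x)
      ultimately show ?thesis by simp
    qed
    then show "\<exists>x. (\<forall>e\<in>edges G. (\<Sum>f\<in>edges G. edge_coeff e f * x f) = 1) \<and>
        (\<forall>e\<in>edges G. x e > 0)"
      by blast
  next
    assume "\<exists>x. (\<forall>e\<in>edges G. (\<Sum>f\<in>edges G. edge_coeff e f * x f) = 1) \<and>
        (\<forall>e\<in>edges G. x e > 0)"
    then obtain x where x: "\<And>e. e \<in> edges G \<Longrightarrow> (\<Sum>f\<in>edges G. edge_coeff e f * x f) = 1"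
      "\<And>e. e \<in> edges G \<Longrightarrow> x e > 0"
      by blast
    let ?v = "vec ?n (\<lambda>j. x (ls ! j))"
    have mem: "ls ! i \<in> edges G" if "i < ?n" for i
      using that assms(3) by (metis nth_mem)
    have "?M *\<^sub>v ?v = ?one"
      using positivity_matrix_mult_vec[OF assms(2,3), of _ x] x(1) mem
        carrier_matD[OF positivity_matrix_carrier[of G ls]]
      by (intro eq_vecI) auto
    then have "B *\<^sub>v ?one = B *\<^sub>v (?M *\<^sub>v ?v)"
      by simp
    also have "\<dots> = (B * ?M) *\<^sub>v ?v"
      by (rule assoc_mult_mat_vec[OF B(2) positivity_matrix_carrier, symmetric]) simp
    finally have "B *\<^sub>v ?one = ?v"
      by (simp add: B(4))
    then show "all_entries_positive G ls"
      using x(2) mem by (simp add: all_entries_positive_def B(1))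
  qed
qed

lemma graph_positive_iff:
  assumes "graph G" "distinct ls" "set ls = edges G"
  shows "graph_positive G \<longleftrightarrow> all_entries_positive G ls"
proof
  assume "graph_positive G"
  then obtain ls' where ls': "distinct ls'" "set ls' = edges G" "all_entries_positive G ls'"
    unfolding graph_positive_def by blast
  then show "all_entries_positive G ls"
    by (simp only: all_entries_positive_iff[OF assms]
        all_entries_positive_iff[OF assms(1) ls'(1,2)])
next
  assume "all_entries_positive G ls"
  then show "graph_positive G"
    unfolding graph_positive_def using assms(2,3) by (intro exI[of _ ls] conjI)
qed

end

theory Submission
  imports Defs
begin

text \<open>
  A positive graph carries a weighting \<open>x\<close> of its edges by positive numbers that solves the linear
  system with matrix \<open>edge_coeff\<close> and right-hand side 1. In terms of the load of a vertex, the
  total weight of the edges at it, the equation of the edge \<open>{a, b}\<close> is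
  \<open>x {a, b} + load a + load b = 1\<close> (\<open>edge_equation\<close>).

  So the weights of the edges that faithful containment controls are functions of the two loads
  \<open>\<alpha>\<close> at \<open>v\<close> and \<open>\<beta>\<close> at \<open>w\<close> alone: the edge \<open>l\<close> has weight \<open>1 - \<alpha> - \<beta>\<close>, a pendant edge at \<open>v\<close> has
  weight \<open>(1 - \<alpha>) / 2\<close>, and the edge at \<open>v\<close> of a triangle over \<open>l\<close> has weight
  \<open>(1 - 2 \<alpha> + \<beta>) / 3\<close>. All other edges at \<open>v\<close> have positive weight, hence \<open>\<alpha>\<close> is at least the sum
  of the weights of these edges, and likewise for \<open>\<beta>\<close>. For each of the seven triples \<open>(r, s, t)\<close> a
  suitable positive combination of the two inequalities yields \<open>\<alpha> + \<beta> \<ge> 1\<close>, which contradicts the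
  positivity of the weight of \<open>l\<close>. The bound depends on the rest of the graph only through
  \<open>\<alpha>\<close> and \<open>\<beta>\<close>, which is why the valencies of \<open>v\<close> and \<open>w\<close> may be arbitrary.
\<close>

definition positive_solution :: "'a graph \<Rightarrow> ('a set \<Rightarrow> real) \<Rightarrow> bool" where
  "positive_solution G x \<longleftrightarrow>
     (\<forall>e\<in>edges G. (\<Sum>f\<in>edges G. edge_coeff e f * x f) = 1) \<and> (\<forall>e\<in>edges G. x e > 0)"

definition load :: "'a graph \<Rightarrow> ('a set \<Rightarrow> real) \<Rightarrow> 'a \<Rightarrow> real" where
  "load G x u = (\<Sum>f | f \<in> edges G \<and> u \<in> f. x f)"

lemma finite_edges:
  assumes "graph G"
  shows "finite (edges G)"
proof -
  have "edges G \<subseteq> Pow (verts G)"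
    using assms by (auto simp: graph_def)
  then show ?thesis
    using assms by (meson finite_Pow_iff finite_subset graph_def)
qed

lemma edge_ends_distinct:
  assumes "graph G" "{a, b} \<in> edges G"
  shows "a \<noteq> b"
  using assms by (auto simp: graph_def)

text \<open>
  Two distinct edges share at most one vertex, so summing the loads at both ends of \<open>{a, b}\<close>
  counts each adjacent edge once and \<open>{a, b}\<close> itself twice; the coefficient 3 on the diagonal
  leaves one more copy of the weight of \<open>{a, b}\<close>.
\<close>

lemma edge_equation:
  assumes "graph G" "positive_solution G x" "{a, b} \<in> edges G"
  shows "x {a, b} + load G x a + load G x b = 1"
proof -
  let ?E = "edges G"
  have fin: "finite ?E"
    using assms(1) by (rule finite_edges)
  have ab: "a \<noteq> b"
    using assms(1,3) by (rule edge_ends_distinct)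
  have coeff: "edge_coeff {a, b} f * x f =
      (if f = {a, b} then x f else 0) + (if a \<in> f then x f else 0) + (if b \<in> f then x f else 0)"
    if f: "f \<in> ?E" for f
  proof -
    have "card f = 2"
      using assms(1) f by (simp add: graph_def)
    then have "{a, b} = f" if "a \<in> f" "b \<in> f"
      using that ab by (intro card_subset_eq card_ge_0_finite) simp_all
    then have "f = {a, b} \<longleftrightarrow> a \<in> f \<and> b \<in> f"
      by blast
    moreover have "{a, b} \<inter> f \<noteq> {} \<longleftrightarrow> a \<in> f \<or> b \<in> f"
      by blast
    ultimately show ?thesis
      by (simp add: edge_coeff_def eq_commute[of "{a, b}" f])
  qed
  have "1 = (\<Sum>f\<in>?E. edge_coeff {a, b} f * x f)"
    using assms(2,3) by (simp add: positive_solution_def)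
  also have "\<dots> = x {a, b} + load G x a + load G x b"
    using fin assms(3)
    by (simp add: coeff sum.distrib load_def sum.inter_filter)
  finally show ?thesis by simp
qed

lemma weight_pendant_edge:
  assumes "graph G" "positive_solution G x" "{v, y} \<in> edges G" "valency G y = 1"
  shows "x {v, y} = (1 - load G x v) / 2"
proof -
  have "card {f \<in> edges G. y \<in> f} = 1"
    using assms(4) by (simp add: valency_def)
  then obtain e where e: "{f \<in> edges G. y \<in> f} = {e}"
    by (rule card_1_singletonE)
  have "{v, y} \<in> {f \<in> edges G. y \<in> f}"
    using assms(3) by simp
  then have "e = {v, y}"
    unfolding e by (rule singletonD[symmetric])
  then have "load G x y = x {v, y}"
    by (simp add: load_def e)
  then show ?thesis
    using edge_equation[OF assms(1-3)] by simp
qed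

text \<open>
  If \<open>y\<close> has no further edges, then its load is the sum of the two weights in question, and the
  equations of \<open>{v, y}\<close> and \<open>{w, y}\<close> are two linear equations that determine both weights.
\<close>

lemma weight_triangle_edge:
  assumes "graph G" "positive_solution G x" "{v, y} \<in> edges G" "{w, y} \<in> edges G"
    and "valency G y = 2" "v \<noteq> w"
  shows "x {v, y} = (1 - 2 * load G x v + load G x w) / 3"
proof -
  have ne: "{v, y} \<noteq> {w, y}"
    using assms(6) by (auto simp: doubleton_eq_iff)
  have "{{v, y}, {w, y}} = {f \<in> edges G. y \<in> f}"
    using assms(3-5) ne finite_edges[OF assms(1)]
    by (intro card_subset_eq) (auto simp: valency_def)
  then have "load G x y = x {v, y} + x {w, y}"
    using ne by (simp add: load_def flip: \<open>_ = {f \<in> edges G. y \<in> f}\<close>)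
  then show ?thesis
    using edge_equation[OF assms(1-3)] edge_equation[OF assms(1,2,4)] by simp
qed

text \<open>
  The edges from \<open>v\<close> to \<open>w\<close>, \<open>R\<close> and \<open>T\<close> are only some of the edges at \<open>v\<close>; positivity of the
  others makes their total a lower bound of the load of \<open>v\<close>. The bound is stated for one end of
  \<open>l\<close>; it serves for both because exchanging \<open>v\<close> and \<open>w\<close> exchanges \<open>R\<close> and \<open>S\<close>.
\<close>

lemma load_lower_bound:
  assumes G: "graph G" and x: "positive_solution G x" and l: "{v, w} \<in> edges G"
    and sub: "R \<subseteq> verts G - {v, w}" "T \<subseteq> verts G - {v, w}" and disj: "R \<inter> T = {}"
    and R: "\<forall>y\<in>R. {v, y} \<in> edges G \<and> valency G y = 1"
    and T: "\<forall>y\<in>T. {v, y} \<in> edges G \<and> {w, y} \<in> edges G \<and> valency G y = 2"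
  shows "load G x v \<ge> 1 - load G x v - load G x w + real (card R) * ((1 - load G x v) / 2)
    + real (card T) * ((1 - 2 * load G x v + load G x w) / 3)"
proof -
  have fin: "finite R" "finite T"
    using G sub by (auto simp: graph_def intro: finite_subset)
  have vw: "v \<noteq> w"
    using G l by (rule edge_ends_distinct)
  have sum_eq_card: "(\<Sum>y\<in>A. x {v, y}) = real (card A) * c"
    if "\<And>y. y \<in> A \<Longrightarrow> x {v, y} = c" for A c
    using that by simp
  have "(\<Sum>y\<in>insert w (R \<union> T). x {v, y}) = (\<Sum>f\<in>(\<lambda>y. {v, y}) ` insert w (R \<union> T). x f)"
    by (subst sum.reindex) (auto simp: inj_on_def doubleton_eq_iff)
  also have "\<dots> \<le> load G x v"
    unfolding load_def using G x l R T finite_edges[OF G]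
    by (intro sum_mono2) (auto simp: positive_solution_def less_imp_le)
  finally have "(\<Sum>y\<in>insert w (R \<union> T). x {v, y}) \<le> load G x v" .
  moreover have "(\<Sum>y\<in>insert w (R \<union> T). x {v, y}) =
      x {v, w} + ((\<Sum>y\<in>R. x {v, y}) + (\<Sum>y\<in>T. x {v, y}))"
    using fin sub disj by (subst sum.insert) (auto simp: sum.union_disjoint)
  moreover have "(\<Sum>y\<in>R. x {v, y}) = real (card R) * ((1 - load G x v) / 2)"
    by (rule sum_eq_card) (use weight_pendant_edge[OF G x] R in blast)
  moreover have "(\<Sum>y\<in>T. x {v, y}) =
      real (card T) * ((1 - 2 * load G x v + load G x w) / 3)"
    by (rule sum_eq_card) (use weight_triangle_edge[OF G x _ _ _ vw] T in blast)
  moreover have "x {v, w} = 1 - load G x v - load G x w"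
    using edge_equation[OF G x l] by simp
  ultimately show ?thesis by linarith
qed

text \<open>
  The purpose is to reduce non-positivity to a question about two real numbers: a graph that
  contains the configuration faithfully is not positive as soon as these inequalities have no
  common solution. The strict one says that \<open>l\<close> has positive weight.
\<close>

lemma load_inequalities:
  assumes G: "graph G" and pos: "graph_positive G" and cont: "contains_faithfully G r s t"
  obtains \<alpha> \<beta> :: real where "\<alpha> + \<beta> < 1"
    and "\<alpha> \<ge> 1 - \<alpha> - \<beta> + real r * ((1 - \<alpha>) / 2) + real t * ((1 - 2 * \<alpha> + \<beta>) / 3)"
    and "\<beta> \<ge> 1 - \<beta> - \<alpha> + real s * ((1 - \<beta>) / 2) + real t * ((1 - 2 * \<beta> + \<alpha>) / 3)"
proof -
  obtain ls where ls: "distinct ls" "set ls = edges G" "all_entries_positive G ls"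
    using pos unfolding graph_positive_def by blast
  then obtain x where x: "positive_solution G x"
    unfolding positive_solution_def all_entries_positive_iff[OF G ls(1,2)] by blast
  obtain v w R S T where l: "{v, w} \<in> edges G"
    and sub: "R \<subseteq> verts G - {v, w}" "S \<subseteq> verts G - {v, w}" "T \<subseteq> verts G - {v, w}"
    and disj: "R \<inter> T = {}" "S \<inter> T = {}"
    and card: "card R = r" "card S = s" "card T = t"
    and R: "\<forall>y\<in>R. {v, y} \<in> edges G \<and> valency G y = 1"
    and S: "\<forall>y\<in>S. {w, y} \<in> edges G \<and> valency G y = 1"
    and T: "\<forall>y\<in>T. {v, y} \<in> edges G \<and> {w, y} \<in> edges G \<and> valency G y = 2"
    using cont unfolding contains_faithfully_def by blast
  have l': "{w, v} \<in> edges G" and sub': "S \<subseteq> verts G - {w, v}" "T \<subseteq> verts G - {w, v}"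
    and T': "\<forall>y\<in>T. {w, y} \<in> edges G \<and> {v, y} \<in> edges G \<and> valency G y = 2"
    using l sub T by (auto simp: insert_commute)
  have "x {v, w} > 0"
    using x l by (simp add: positive_solution_def)
  then have "load G x v + load G x w < 1"
    using edge_equation[OF G x l] by linarith
  then show ?thesis
    using load_lower_bound[OF G x l sub(1,3) disj(1) R T]
      load_lower_bound[OF G x l' sub' disj(2) S T'] unfolding card by (rule that)
qed

theorem proposition5p6:
  fixes G :: "'a graph"
  assumes "graph G"
    and "(r, s, t) \<in> {(2, 2, 0), (0, 0, 3), (2, 1, 1), (4, 1, 0), (2, 0, 2), (4, 0, 1), (1, 1, 2)}"
    and "contains_faithfully G r s t"
  shows "\<not> graph_positive G"
proof
  assume "graph_positive G"
  then obtain \<alpha> \<beta> :: real where less: "\<alpha> + \<beta> < 1"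
    and \<alpha>: "\<alpha> \<ge> 1 - \<alpha> - \<beta> + real r * ((1 - \<alpha>) / 2) + real t * ((1 - 2 * \<alpha> + \<beta>) / 3)"
    and \<beta>: "\<beta> \<ge> 1 - \<beta> - \<alpha> + real s * ((1 - \<beta>) / 2) + real t * ((1 - 2 * \<beta> + \<alpha>) / 3)"
    using load_inequalities[OF assms(1) _ assms(3)] by blast
  \<comment> \<open>For instance \<open>(2, 1, 1)\<close> gives \<open>11 \<alpha> + 2 \<beta> \<ge> 7\<close> and \<open>4 \<alpha> + 19 \<beta> \<ge> 11\<close>; five times the first
      plus three times the second is \<open>67 (\<alpha> + \<beta>) \<ge> 68\<close>.\<close>
  consider "r = 2" "s = 2" "t = 0" | "r = 0" "s = 0" "t = 3" | "r = 2" "s = 1" "t = 1"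
    | "r = 4" "s = 1" "t = 0" | "r = 2" "s = 0" "t = 2" | "r = 4" "s = 0" "t = 1"
    | "r = 1" "s = 1" "t = 2"
    using assms(2) by auto
  then show False
    by cases (insert less \<alpha> \<beta>, simp only: of_nat_numeral of_nat_0 of_nat_1, simp add: field_simps)+
qed

end
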